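(* Let $\mathbb{F}_q$ be a finite field with $q$ elements and let $V_q=\mathbb{F}_q^{[\omega]}$. Let $V$ be a linear subspace of $V_q$ of countably infinite dimension, let $k\in\omega$, and let $\Delta$ be a colouring of the elements of $V$ with the two colours red and blue such that $V$ contains no affine subspace of dimension $k$ all of whose elements are red. Then there exists an affine subspace of $V$ of infinite dimension all of whose elements are blue.
   Context: $\mathbb{F}_q^{[\omega]}$ denotes the $\mathbb{F}_q$-vector space of all functions $h:\omega\to\mathbb{F}_q$ taking nonzero values only finitely many times, with pointwise operations. An affine subspace of a vector space $V$ is a set of the form $v+W=\{v+w: w\in W\}$ with $v\in V$ and $W$ a linear subspace of $V$; its dimension is the dimension of $W$. *)

theory Defs
  imports Complex_Main "HOL-Library.Poly_Mapping" "HOL-Library.Countable_Set"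
begin

lift_definition fs_scale :: "'a::field \<Rightarrow> (nat \<Rightarrow>\<^sub>0 'a) \<Rightarrow> (nat \<Rightarrow>\<^sub>0 'a)"
  is "\<lambda>c h n. c * h n"
  by (rule finite_subset) auto

text \<open>The vector space of all finitely supported functions from the natural numbers to a field,
  with pointwise operations (addition is that of the type of finitely supported functions).\<close>

global_interpretation fs: vector_space "fs_scale :: 'a::field \<Rightarrow> (nat \<Rightarrow>\<^sub>0 'a) \<Rightarrow> (nat \<Rightarrow>\<^sub>0 'a)"
  by unfold_locales
    (transfer, simp add: fun_eq_iff algebra_simps)+

text \<open>Finite-dimensionality has to be stated separately, because \<^term>\<open>fs.dim\<close> is a natural
  number and carries no information about spaces without a finite basis.\<close>

definition finite_dim :: "(nat \<Rightarrow>\<^sub>0 'a::field) set \<Rightarrow> bool" where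
  "finite_dim W \<longleftrightarrow> (\<exists>B. finite B \<and> fs.independent B \<and> fs.span B = W)"

definition countably_infinite_dim :: "(nat \<Rightarrow>\<^sub>0 'a::field) set \<Rightarrow> bool" where
  "countably_infinite_dim W \<longleftrightarrow>
     (\<exists>B. countable B \<and> infinite B \<and> fs.independent B \<and> fs.span B = W)"

text \<open>\<open>A = v + W\<close> is an affine subspace, with direction \<open>W\<close>, of the vector space \<open>V\<close>.\<close>

definition affine_subspace_along ::
    "(nat \<Rightarrow>\<^sub>0 'a::field) set \<Rightarrow> (nat \<Rightarrow>\<^sub>0 'a) set \<Rightarrow> (nat \<Rightarrow>\<^sub>0 'a) set \<Rightarrow> bool" where
  "affine_subspace_along V W A \<longleftrightarrow>
     fs.subspace W \<and> W \<subseteq> V \<and> (\<exists>v\<in>V. A = {v + w | w. w \<in> W})"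

definition affine_subspace_of_dim ::
    "(nat \<Rightarrow>\<^sub>0 'a::field) set \<Rightarrow> nat \<Rightarrow> (nat \<Rightarrow>\<^sub>0 'a) set \<Rightarrow> bool" where
  "affine_subspace_of_dim V k A \<longleftrightarrow>
     (\<exists>W. affine_subspace_along V W A \<and> finite_dim W \<and> fs.dim W = k)"

definition affine_subspace_of_infinite_dim ::
    "(nat \<Rightarrow>\<^sub>0 'a::field) set \<Rightarrow> (nat \<Rightarrow>\<^sub>0 'a) set \<Rightarrow> bool" where
  "affine_subspace_of_infinite_dim V A \<longleftrightarrow>
     (\<exists>W. affine_subspace_along V W A \<and> \<not> finite_dim W)"

datatype colour = Red | Blue

end

theory Submission
  imports Defs "HOL-Library.FuncSet"
begin

text \<open>
  Call a set of vectors small if for some \<open>m\<close> it contains no affine subspace of dimension \<open>m\<close>. Over a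
  finite field the small sets form an ideal: this is finite Ramsey theory (\<open>contains_flat_Un\<close>), and
  it follows from the Hales--Jewett theorem over the alphabet of all coordinate vectors of length
  \<open>m\<close>. A combinatorial line in that alphabet is the same thing as a suitable \<open>m\<close>-dimensional
  affine subspace of a space with \<open>n * m\<close> basis vectors. The ideal is moreover invariant under the
  homotheties \<open>x \<mapsto> a + c x\<close> with \<open>c \<noteq> 0\<close>.

  With this ideal, a blue affine subspace of infinite dimension can be built greedily
  (\<open>extend_flat_avoiding_small\<close>). Suppose that \<open>a + U\<close> is blue and \<open>U\<close> is finite. A vector \<open>x\<close>
  outside \<open>U\<close> is a good new direction unless \<open>a + w + c x\<close> is red for some \<open>w \<in> U\<close> and some
  scalar \<open>c \<noteq> 0\<close>. The bad directions are therefore a union of finitely many homothetic preimages of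
  the red set. The red set is small by assumption, and so is \<open>U\<close>; hence the vectors to be avoided form a
  small set. The whole space, having infinite dimension, is not small, so a good \<open>x\<close> remains, and
  the construction never stops.
\<close>

section \<open>The Hales--Jewett theorem\<close>

definition words :: "nat \<Rightarrow> 'a set \<Rightarrow> 'a list set" where
  "words n A = {w. set w \<subseteq> A \<and> length w = n}"

text \<open>A pattern stands for a combinatorial line: its points are obtained by substituting one letter of
  the alphabet for all the wildcards \<^const>\<open>None\<close>, of which there is at least one.\<close>

definition patterns :: "nat \<Rightarrow> 'a set \<Rightarrow> 'a option list set" where
  "patterns n A = {T. set T \<subseteq> insert None (Some ` A) \<and> length T = n \<and> None \<in> set T}"

definition fill :: "'a option list \<Rightarrow> 'a \<Rightarrow> 'a list" where
  "fill T x = map (case_option x (\<lambda>a. a)) T"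

definition hales_jewett :: "'a set \<Rightarrow> nat \<Rightarrow> nat \<Rightarrow> bool" where
  "hales_jewett A r n \<longleftrightarrow> (\<forall>\<chi>. \<chi> ` words n A \<subseteq> {..<r} \<longrightarrow>
     (\<exists>T\<in>patterns n A. \<exists>c::nat. \<forall>x\<in>A. \<chi> (fill T x) = c))"

lemma fill_append [simp]: "fill (S @ T) x = fill S x @ fill T x"
  by (simp add: fill_def)

lemma fill_constant [simp]: "fill (map Some w) x = w"
  by (simp add: fill_def comp_def)

lemma append_in_words: "u \<in> words m A \<Longrightarrow> w \<in> words n A \<Longrightarrow> u @ w \<in> words (m + n) A"
  by (auto simp: words_def)

lemma fill_in_words: "T \<in> patterns n A \<Longrightarrow> x \<in> A \<Longrightarrow> fill T x \<in> words n A"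
  by (force simp: patterns_def words_def fill_def split: option.splits)

lemma patterns_append:
  "S \<in> patterns m A \<Longrightarrow> T \<in> patterns n A \<Longrightarrow> S @ T \<in> patterns (m + n) A"
  "w \<in> words m A \<Longrightarrow> T \<in> patterns n A \<Longrightarrow> map Some w @ T \<in> patterns (m + n) A"
  "S \<in> patterns m A \<Longrightarrow> w \<in> words n A \<Longrightarrow> S @ map Some w \<in> patterns (m + n) A"
  by (auto simp: patterns_def words_def)

lemma words_mono: "A \<subseteq> B \<Longrightarrow> words n A \<subseteq> words n B"
  by (auto simp: words_def)

lemma patterns_mono: "A \<subseteq> B \<Longrightarrow> patterns n A \<subseteq> patterns n B"
  by (auto simp: patterns_def)

text \<open>Colourings in the sense of \<open>hales_jewett\<close> take natural numbers as colours, so that the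
  definition has no type of colours as a parameter. The induction below uses colours that are
  functions, and this lemma transfers the property to them.\<close>

lemma hales_jewett_finite_range:
  assumes "hales_jewett A (card C) n" "finite C" "\<chi> ` words n A \<subseteq> C"
  obtains T c where "T \<in> patterns n A" "\<And>x. x \<in> A \<Longrightarrow> \<chi> (fill T x) = c"
proof -
  obtain h where h: "bij_betw h C {..<card C}"
    using ex_bij_betw_finite_nat[OF assms(2)] by (auto simp: atLeast0LessThan)
  have "(h \<circ> \<chi>) ` words n A \<subseteq> {..<card C}"
    using assms(3) h by (auto simp: bij_betw_def)
  then obtain T c where T: "T \<in> patterns n A" "\<forall>x\<in>A. (h \<circ> \<chi>) (fill T x) = c"
    using assms(1) unfolding hales_jewett_def by blast
  have "\<chi> (fill T x) = inv_into C h c" if "x \<in> A" for x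
  proof -
    have "\<chi> (fill T x) \<in> C" using assms(3) fill_in_words[OF T(1) that] by auto
    thus ?thesis using T(2) that h by (metis bij_betw_inv_into_left comp_apply)
  qed
  with T(1) that show thesis by blast
qed

text \<open>A family of lines is focused at \<open>f\<close> if all of them pass through \<open>f\<close> when the additional
  letter \<open>b\<close> is substituted, while each is monochromatic on the letters of \<open>A\<close>. Indexing the
  family by the set \<open>K\<close> of its colours makes the lines pairwise differently coloured.\<close>

definition focused :: "('a list \<Rightarrow> nat) \<Rightarrow> nat \<Rightarrow> 'a set \<Rightarrow> 'a \<Rightarrow> 'a list \<Rightarrow> nat set \<Rightarrow> bool" where
  "focused \<chi> n A b f K \<longleftrightarrow> (\<forall>c\<in>K. \<exists>T\<in>patterns n (insert b A).
     fill T b = f \<and> (\<forall>x\<in>A. \<chi> (fill T x) = c))"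

text \<open>Each step lengthens the words by a prefix of length \<open>m\<close>, chosen so large that on some line \<open>T\<close> of
  prefixes the letters of \<open>A\<close> are indistinguishable: the colour of a word does not depend on which of
  them is substituted in \<open>T\<close>, whatever the suffix is. Moving along \<open>T\<close> simultaneously with each
  of the old focused lines gives lines focused at the point \<open>T(b) f\<close>, and \<open>T\<close> followed by the constant \<open>f\<close> is one
  more such line. Its colour is new, or else it completes one of the old lines to a line that is
  monochromatic on all letters.\<close>

lemma colour_focusing:
  assumes "finite A" "A \<noteq> {}" and HJ: "\<And>r. \<exists>n. hales_jewett A r n"
  shows "\<exists>n. \<forall>\<chi>. \<chi> ` words n (insert b A) \<subseteq> {..<r} \<longrightarrow>
    (\<exists>T\<in>patterns n (insert b A). \<exists>c. \<forall>x\<in>insert b A. \<chi> (fill T x) = c) \<or>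
    (\<exists>f\<in>words n (insert b A). \<exists>K\<subseteq>{..<r}. card K = s \<and> focused \<chi> n A b f K)"
proof (induction s)
  case 0
  show ?case
    by (rule exI[of _ 0]) (simp add: words_def focused_def exI[of _ "{}"])
next
  case (Suc s)
  let ?A = "insert b A"
  obtain n where n: "\<And>\<chi>. \<chi> ` words n ?A \<subseteq> {..<r} \<Longrightarrow>
    (\<exists>T\<in>patterns n ?A. \<exists>c. \<forall>x\<in>?A. \<chi> (fill T x) = c) \<or>
    (\<exists>f\<in>words n ?A. \<exists>K\<subseteq>{..<r}. card K = s \<and> focused \<chi> n A b f K)"
    using Suc.IH by blast
  \<comment> \<open>The colour of a prefix is the function that gives the colours of all its extensions.\<close>
  define C where "C = words n ?A \<rightarrow>\<^sub>E {..<r}"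
  have "finite C"
    unfolding C_def words_def using assms(1) by (intro finite_PiE finite_lists_length_eq) auto
  obtain m where m: "hales_jewett A (card C) m"
    using HJ by blast
  have "(\<exists>T\<in>patterns (m + n) ?A. \<exists>c. \<forall>x\<in>?A. \<chi> (fill T x) = c) \<or>
    (\<exists>f\<in>words (m + n) ?A. \<exists>K\<subseteq>{..<r}. card K = Suc s \<and> focused \<chi> (m + n) A b f K)"
    if \<chi>: "\<chi> ` words (m + n) ?A \<subseteq> {..<r}" for \<chi> :: "'a list \<Rightarrow> nat"
  proof -
    have "(\<lambda>u. restrict (\<lambda>w. \<chi> (u @ w)) (words n ?A)) ` words m A \<subseteq> C"
    proof (rule image_subsetI)
      fix u assume "u \<in> words m A"
      hence "u @ w \<in> words (m + n) ?A" if "w \<in> words n ?A" for w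
        using words_mono[of A ?A m] append_in_words that by blast
      thus "restrict (\<lambda>w. \<chi> (u @ w)) (words n ?A) \<in> C"
        using \<chi> by (auto simp: C_def restrict_PiE_iff)
    qed
    from hales_jewett_finite_range[OF m \<open>finite C\<close> this]
    obtain T g where T: "T \<in> patterns m A"
      and g: "\<And>x. x \<in> A \<Longrightarrow> restrict (\<lambda>w. \<chi> (fill T x @ w)) (words n ?A) = g" by metis
    obtain a where a: "a \<in> A" using assms(2) by blast
    define u where "u = fill T a"
    have swap: "\<chi> (fill T x @ w) = \<chi> (u @ w)" if "x \<in> A" "w \<in> words n ?A" for x w
      using g[OF that(1)] g[OF a] that(2) unfolding u_def by (metis restrict_apply')
    have T': "T \<in> patterns m ?A" using T patterns_mono[of A ?A m] by blast
    have u: "u \<in> words m ?A" unfolding u_def using T' a by (intro fill_in_words) auto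
    define \<chi>' where "\<chi>' w = \<chi> (u @ w)" for w
    have "\<chi>' ` words n ?A \<subseteq> {..<r}"
      using \<chi> append_in_words[OF u] by (auto simp: \<chi>'_def)
    from n[OF this] show ?thesis
    proof (elim disjE bexE exE conjE)
      fix T1 c assume "T1 \<in> patterns n ?A" "\<forall>x\<in>?A. \<chi>' (fill T1 x) = c"
      thus ?thesis
        using patterns_append(2)[OF u] by (intro disjI1 bexI[of _ "map Some u @ T1"]) (auto simp: \<chi>'_def)
    next
      fix f K assume f: "f \<in> words n ?A" and K: "K \<subseteq> {..<r}" "card K = s"
        and foc: "focused \<chi>' n A b f K"
      define c where "c = \<chi>' f"
      show ?thesis
      \<comment> \<open>If \<open>c\<close> is in \<open>K\<close>, the line of that colour is extended monochromatically by its own focus.\<close>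
      proof (cases "c \<in> K")
        case True
        then obtain T1 where T1: "T1 \<in> patterns n ?A" "fill T1 b = f" "\<forall>x\<in>A. \<chi>' (fill T1 x) = c"
          using foc unfolding focused_def by blast
        hence "\<forall>x\<in>?A. \<chi> (fill (map Some u @ T1) x) = c"
          by (auto simp: c_def \<chi>'_def)
        thus ?thesis using patterns_append(2)[OF u T1(1)] by blast
      next
        case False
        have "focused \<chi> (m + n) A b (fill T b @ f) (insert c K)"
          unfolding focused_def
        proof (intro ballI, elim insertE)
          fix d assume "d = c"
          thus "\<exists>S\<in>patterns (m + n) ?A. fill S b = fill T b @ f \<and> (\<forall>x\<in>A. \<chi> (fill S x) = d)"
            using patterns_append(3)[OF T' f] swap f
            by (intro bexI[of _ "T @ map Some f"]) (auto simp: c_def \<chi>'_def)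
        next
          fix d assume "d \<in> K"
          then obtain T1 where T1: "T1 \<in> patterns n ?A" "fill T1 b = f" "\<forall>x\<in>A. \<chi>' (fill T1 x) = d"
            using foc unfolding focused_def by blast
          have "\<forall>x\<in>A. \<chi> (fill (T @ T1) x) = d"
            using swap fill_in_words[OF T1(1)] T1(3) by (simp add: \<chi>'_def)
          thus "\<exists>S\<in>patterns (m + n) ?A. fill S b = fill T b @ f \<and> (\<forall>x\<in>A. \<chi> (fill S x) = d)"
            using patterns_append(1)[OF T' T1(1)] T1(2) by (intro bexI[of _ "T @ T1"]) auto
        qed
        moreover have "fill T b @ f \<in> words (m + n) ?A"
          using append_in_words[OF fill_in_words[OF T'] f] by simp
        moreover have "c < r" using \<open>\<chi>' ` words n ?A \<subseteq> {..<r}\<close> f by (auto simp: c_def)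
        moreover have "card (insert c K) = Suc s"
          using False K finite_subset[OF K(1)] by simp
        ultimately show ?thesis using K(1)
          by (intro disjI2 bexI[of _ "fill T b @ f"] exI[of _ "insert c K"]) auto
      qed
    qed
  qed
  thus ?case by blast
qed

theorem ex_hales_jewett:
  assumes "finite A" "A \<noteq> {}"
  shows "\<exists>n. hales_jewett A r n"
  using assms
proof (induction A arbitrary: r rule: finite_ne_induct)
  case (singleton b)
  have "[None] \<in> patterns 1 {b}" by (simp add: patterns_def)
  hence "hales_jewett {b} r 1" unfolding hales_jewett_def by auto
  thus ?case ..
next
  case (insert b A)
  obtain n where n: "\<And>\<chi>. \<chi> ` words n (insert b A) \<subseteq> {..<r} \<Longrightarrow>
    (\<exists>T\<in>patterns n (insert b A). \<exists>c. \<forall>x\<in>insert b A. \<chi> (fill T x) = c) \<or>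
    (\<exists>f\<in>words n (insert b A). \<exists>K\<subseteq>{..<r}. card K = Suc r \<and> focused \<chi> n A b f K)"
    using colour_focusing[OF insert.hyps(1,2) insert.IH] by metis
  \<comment> \<open>There is no room for more focused lines than colours, which excludes the second alternative.\<close>
  have few: "card K \<noteq> Suc r" if "K \<subseteq> {..<r}" for K
    using card_mono[OF _ that] by simp
  have "hales_jewett (insert b A) r n"
    unfolding hales_jewett_def
  proof (intro allI impI)
    fix \<chi> :: "'a list \<Rightarrow> nat" assume "\<chi> ` words n (insert b A) \<subseteq> {..<r}"
    from n[OF this] few
    show "\<exists>T\<in>patterns n (insert b A). \<exists>c. \<forall>x\<in>insert b A. \<chi> (fill T x) = c"
      by (elim disjE bexE exE conjE) metis+
  qed
  thus ?case ..
qed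

section \<open>Sets without large affine subspaces\<close>

context vector_space
begin

text \<open>Linear independence is needed below for vectors indexed by pairs; stating it for families
  includes injectivity of the indexing.\<close>

lemma independent_family_iff:
  assumes "finite I"
  shows "inj_on b I \<and> independent (b ` I) \<longleftrightarrow>
    (\<forall>c. (\<Sum>i\<in>I. c i *s b i) = 0 \<longrightarrow> (\<forall>i\<in>I. c i = 0))"
proof (intro iffI conjI allI impI)
  assume b: "inj_on b I \<and> independent (b ` I)"
  fix c assume c: "(\<Sum>i\<in>I. c i *s b i) = 0"
  have sum: "(\<Sum>v\<in>b ` I. c (inv_into I b v) *s v) = 0"
    using b c by (simp add: sum.reindex)
  have zero: "c (inv_into I b v) = 0" if "v \<in> b ` I" for v
    using independentD[of "b ` I" "b ` I" "\<lambda>v. c (inv_into I b v)" v] that sum b assms by simp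
  show "\<forall>i\<in>I. c i = 0"
  proof
    fix i assume "i \<in> I"
    thus "c i = 0" using zero[of "b i"] b by (simp add: inv_into_f_f)
  qed
next
  assume b: "\<forall>c. (\<Sum>i\<in>I. c i *s b i) = 0 \<longrightarrow> (\<forall>i\<in>I. c i = 0)"
  show inj: "inj_on b I"
  proof (rule inj_onI, rule ccontr)
    fix i j assume ij: "i \<in> I" "j \<in> I" "b i = b j" "i \<noteq> j"
    \<comment> \<open>A repeated vector gives the nontrivial relation \<open>b i - b j = 0\<close>.\<close>
    let ?d = "\<lambda>i k. if k = i then 1 else 0 :: 'a"
    have *: "(\<Sum>k\<in>I. ?d l k *s b k) = b l" if "l \<in> I" for l
      using that assms by (simp add: if_distrib[of "\<lambda>c. c *s _"] cong: if_cong)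
    have "(\<Sum>k\<in>I. (?d i k - ?d j k) *s b k) = 0"
      unfolding scale_left_diff_distrib sum_subtractf using *[OF ij(1)] *[OF ij(2)] ij(3) by simp
    hence "?d i i - ?d j i = 0" using b[rule_format, of "\<lambda>k. ?d i k - ?d j k"] ij(1) by blast
    thus False using ij(4) by simp
  qed
  show "independent (b ` I)"
  proof (rule independent_if_scalars_zero)
    show "finite (b ` I)" using assms by simp
    fix f v assume f: "(\<Sum>x\<in>b ` I. f x *s x) = 0" and v: "v \<in> b ` I"
    from f have "(\<Sum>i\<in>I. f (b i) *s b i) = 0" using inj by (simp add: sum.reindex)
    thus "f v = 0" using b[rule_format, of "\<lambda>i. f (b i)"] v by blast
  qed
qed

end

locale finite_field_vector_space = vector_space scale
  for scale :: "'a::field \<Rightarrow> 'b::ab_group_add \<Rightarrow> 'b" (infixr \<open>*s\<close> 75) +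
  assumes finite_scalars: "finite (UNIV :: 'a set)"
begin

lemma finite_span:
  assumes "finite B"
  shows "finite (span B)"
  using assms
proof (induction B rule: finite_induct)
  case empty
  show ?case by simp
next
  case (insert x B)
  have "span (insert x B) \<subseteq> (\<Union>k. (\<lambda>y. y + k *s x) ` span B)"
  proof
    fix y assume "y \<in> span (insert x B)"
    then obtain k where "y - k *s x \<in> span B" by (auto simp: span_insert)
    hence "y - k *s x + k *s x \<in> (\<lambda>y. y + k *s x) ` span B" by (rule imageI)
    thus "y \<in> (\<Union>k. (\<lambda>y. y + k *s x) ` span B)" by auto
  qed
  thus ?case using insert.IH finite_scalars by (meson finite_UN_I finite_imageI finite_subset)
qed

definition contains_flat :: "nat \<Rightarrow> 'b set \<Rightarrow> bool" where
  "contains_flat m S \<longleftrightarrow>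
     (\<exists>v B. finite B \<and> card B = m \<and> independent B \<and> (+) v ` span B \<subseteq> S)"

definition small :: "'b set \<Rightarrow> bool" where
  "small S \<longleftrightarrow> (\<exists>m. \<not> contains_flat m S)"

lemma contains_flat_mono:
  assumes "contains_flat n R" "m \<le> n" "R \<subseteq> S"
  shows "contains_flat m S"
proof -
  obtain v B where B: "finite B" "card B = n" "independent B" "(+) v ` span B \<subseteq> R"
    using assms(1) by (auto simp: contains_flat_def)
  obtain C where C: "C \<subseteq> B" "card C = m"
    using obtain_subset_with_card_n[of m B] B(2) assms(2) by blast
  have "(+) v ` span C \<subseteq> S" using span_mono[OF C(1)] B(4) assms(3) by blast
  thus ?thesis unfolding contains_flat_def
    using C finite_subset[OF C(1) B(1)] independent_mono[OF B(3) C(1)] by blast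
qed

lemma small_subset: "small S \<Longrightarrow> R \<subseteq> S \<Longrightarrow> small R"
  unfolding small_def using contains_flat_mono by blast

text \<open>This is where the Hales--Jewett theorem enters. Letters are coordinate vectors with \<open>m\<close> entries,
  and a word \<open>w\<close> of length \<open>n\<close> encodes the point \<open>\<phi> w\<close> whose \<open>n * m\<close> coordinates are the
  entries of its letters. On a line with wildcard positions \<open>M\<close>, the letter \<open>x\<close> contributes
  \<open>\<Sum>j. x j * e j\<close> with \<open>e j = \<Sum>i\<in>M. h (i, j)\<close>. These \<open>e j\<close> are sums over disjoint nonempty
  blocks of a basis, hence independent, and the line is an affine subspace of dimension \<open>m\<close>.\<close>

proposition contains_flat_Un:
  "\<exists>N. \<forall>R S. contains_flat N (R \<union> S) \<longrightarrow> contains_flat m R \<or> contains_flat m S"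
proof -
  define A where "A = {..<m} \<rightarrow>\<^sub>E (UNIV :: 'a set)"
  have "finite A" unfolding A_def using finite_scalars by (intro finite_PiE) auto
  moreover have "A \<noteq> {}" unfolding A_def by (simp add: PiE_eq_empty_iff)
  ultimately obtain n where n: "hales_jewett A 2 n" using ex_hales_jewett by blast
  have "contains_flat m R \<or> contains_flat m S" if RS: "contains_flat (n * m) (R \<union> S)" for R S
  proof -
    obtain v B where B: "finite B" "card B = n * m" "independent B" "(+) v ` span B \<subseteq> R \<union> S"
      using RS by (auto simp: contains_flat_def)
    let ?I = "{..<n} \<times> {..<m}"
    have "finite ?I" "card ?I = card B" using B(2) by simp_all
    then obtain h where h: "bij_betw h ?I B"
      using finite_same_card_bij[OF _ B(1)] by blast
    have h_indep: "c i j = 0" if "(\<Sum>i<n. \<Sum>j<m. c i j *s h (i, j)) = 0" "i < n" "j < m" for c i j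
    proof -
      have "(\<Sum>p\<in>?I. case_prod c p *s h p) = 0"
        using that(1) by (simp add: sum.cartesian_product case_prod_beta)
      moreover have "inj_on h ?I \<and> independent (h ` ?I)" using h B(3) by (auto simp: bij_betw_def)
      ultimately have "\<forall>p\<in>?I. case_prod c p = 0"
        using independent_family_iff[of ?I h] by blast
      thus ?thesis using that(2,3) by auto
    qed
    define \<phi> where "\<phi> w = v + (\<Sum>i<n. \<Sum>j<m. (w ! i) j *s h (i, j))" for w
    have \<phi>: "\<phi> w \<in> R \<union> S" for w
    proof -
      have "h (i, j) \<in> span B" if "i < n" "j < m" for i j
        using that h by (intro span_base) (auto simp: bij_betw_def)
      hence "(\<Sum>i<n. \<Sum>j<m. (w ! i) j *s h (i, j)) \<in> span B"
        by (intro span_sum span_scale) auto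
      thus ?thesis using B(4) by (auto simp: \<phi>_def)
    qed
    have "(\<lambda>w. if \<phi> w \<in> R then 0 else 1) ` words n A \<subseteq> {..<2::nat}" by auto
    with n obtain T c where T: "T \<in> patterns n A"
      and c: "\<And>x. x \<in> A \<Longrightarrow> (if \<phi> (fill T x) \<in> R then 0 else 1 :: nat) = c"
      unfolding hales_jewett_def by blast
    define M where "M = {i. i < n \<and> T ! i = None}"
    define t where "t i = (case T ! i of None \<Rightarrow> (\<lambda>_. 0) | Some y \<Rightarrow> y)" for i
    define e where "e j = (\<Sum>i\<in>M. h (i, j))" for j
    \<comment> \<open>The part of the line that does not depend on the substituted letter.\<close>
    define v' where "v' = v + (\<Sum>i<n. \<Sum>j<m. t i j *s h (i, j))"
    have len: "length T = n" using T by (simp add: patterns_def)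
    have e_sum: "(\<Sum>j<m. x j *s e j) = (\<Sum>i<n. \<Sum>j<m. (if i \<in> M then x j else 0) *s h (i, j))" for x
    proof -
      have "(\<Sum>j<m. x j *s e j) = (\<Sum>j<m. \<Sum>i\<in>M. x j *s h (i, j))"
        by (simp add: e_def scale_sum_right)
      also have "\<dots> = (\<Sum>i\<in>M. \<Sum>j<m. x j *s h (i, j))"
        by (rule sum.swap)
      also have "\<dots> = (\<Sum>i<n. \<Sum>j<m. (if i \<in> M then x j else 0) *s h (i, j))"
        by (intro sum.mono_neutral_cong_left) (auto simp: M_def intro: sum.neutral)
      finally show ?thesis .
    qed
    have line: "\<phi> (fill T x) = v' + (\<Sum>j<m. x j *s e j)" for x
    proof -
      have "(fill T x ! i) j = t i j + (if i \<in> M then x j else 0)" if "i < n" for i j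
        using that len by (auto simp: fill_def t_def M_def split: option.split)
      hence "(\<Sum>i<n. \<Sum>j<m. (fill T x ! i) j *s h (i, j)) =
          (\<Sum>i<n. \<Sum>j<m. t i j *s h (i, j)) + (\<Sum>j<m. x j *s e j)"
        unfolding e_sum sum.distrib[symmetric] scale_left_distrib[symmetric] by simp
      thus ?thesis by (simp add: \<phi>_def v'_def add.assoc)
    qed
    \<comment> \<open>Independence of the \<open>e j\<close> can be read off at a single wildcard position.\<close>
    obtain i\<^sub>0 where i0: "i\<^sub>0 \<in> M"
      using T len by (auto simp: M_def patterns_def in_set_conv_nth)
    have "\<forall>x. (\<Sum>j<m. x j *s e j) = 0 \<longrightarrow> (\<forall>j\<in>{..<m}. x j = 0)"
    proof (intro allI impI ballI)
      fix x j assume "(\<Sum>j<m. x j *s e j) = 0" "j \<in> {..<m}"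
      thus "x j = 0"
        using h_indep[of "\<lambda>i j. if i \<in> M then x j else 0" i\<^sub>0 j] i0 by (simp add: e_sum M_def)
    qed
    hence e: "inj_on e {..<m}" "independent (e ` {..<m})"
      using independent_family_iff[of "{..<m}" e] by auto
    have mono: "(if y \<in> R then 0 else 1 :: nat) = c" "y \<in> R \<union> S"
      if y: "y \<in> (+) v' ` span (e ` {..<m})" for y
    proof -
      obtain u where "y = v' + (\<Sum>z\<in>e ` {..<m}. u z *s z)"
        using y span_finite[of "e ` {..<m}"] by auto
      also have "\<dots> = v' + (\<Sum>j<m. u (e j) *s e j)" using e(1) by (simp add: sum.reindex)
      also have "\<dots> = \<phi> (fill T (\<lambda>j\<in>{..<m}. u (e j)))" by (simp add: line)
      finally have y: "y = \<phi> (fill T (\<lambda>j\<in>{..<m}. u (e j)))" .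
      have "(\<lambda>j\<in>{..<m}. u (e j)) \<in> A" by (simp add: A_def)
      from c[OF this] show "(if y \<in> R then 0 else 1 :: nat) = c" unfolding y .
      show "y \<in> R \<union> S" unfolding y by (rule \<phi>)
    qed
    have "(+) v' ` span (e ` {..<m}) \<subseteq> R \<or> (+) v' ` span (e ` {..<m}) \<subseteq> S"
    proof (cases "c = 0")
      case True
      hence "y \<in> R" if "y \<in> (+) v' ` span (e ` {..<m})" for y
        using mono(1)[OF that] by (auto split: if_splits)
      thus ?thesis by blast
    next
      case False
      hence "y \<in> S" if "y \<in> (+) v' ` span (e ` {..<m})" for y
        using mono[OF that] by (auto split: if_splits)
      thus ?thesis by blast
    qed
    moreover have "finite (e ` {..<m})" "card (e ` {..<m}) = m"
      using e(1) by (simp_all add: card_image)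
    ultimately show ?thesis unfolding contains_flat_def using e(2) by blast
  qed
  thus ?thesis by blast
qed

lemma small_Un:
  assumes "small R" "small S"
  shows "small (R \<union> S)"
proof -
  obtain k l where "\<not> contains_flat k R" "\<not> contains_flat l S"
    using assms by (auto simp: small_def)
  hence "\<not> contains_flat (max k l) R" "\<not> contains_flat (max k l) S"
    by (meson contains_flat_mono max.cobounded1 max.cobounded2 order_refl)+
  thus ?thesis unfolding small_def using contains_flat_Un[of "max k l"] by blast
qed

lemma small_empty: "small {}"
  unfolding small_def contains_flat_def using span_zero by blast

lemma small_UN:
  assumes "finite I" "\<And>i. i \<in> I \<Longrightarrow> small (S i)"
  shows "small (\<Union>i\<in>I. S i)"
  using assms by (induction I rule: finite_induct) (auto intro: small_Un small_empty)

text \<open>The homothety is a bijection that maps affine subspaces to affine subspaces of the same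
  dimension.\<close>

lemma small_homothety_vimage:
  assumes "small R" "c \<noteq> 0"
  shows "small {x. a + c *s x \<in> R}"
proof -
  have "contains_flat m R" if flat: "contains_flat m {x. a + c *s x \<in> R}" for m
  proof -
    obtain v B where B: "finite B" "card B = m" "independent B"
      and v: "(+) v ` span B \<subseteq> {x. a + c *s x \<in> R}"
      using flat by (auto simp: contains_flat_def)
    have "(a + c *s v) + w \<in> R" if "w \<in> span B" for w
    proof -
      have "a + c *s (v + inverse c *s w) \<in> R" using v span_scale[OF that] by auto
      thus ?thesis using assms(2) by (simp add: scale_right_distrib add.assoc)
    qed
    thus ?thesis unfolding contains_flat_def using B by blast
  qed
  thus ?thesis using assms(1) by (auto simp: small_def)
qed

lemma small_span:
  assumes "finite B"
  shows "small (span B)"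
proof -
  have "\<not> contains_flat (Suc (card B)) (span B)"
  proof
    assume "contains_flat (Suc (card B)) (span B)"
    then obtain v C where C: "card C = Suc (card B)" "independent C" "(+) v ` span C \<subseteq> span B"
      by (auto simp: contains_flat_def)
    have v: "v + w \<in> span B" if "w \<in> span C" for w using C(3) that by blast
    have "C \<subseteq> span B"
    proof
      fix w assume "w \<in> C"
      hence "(v + w) - (v + 0) \<in> span B" by (intro span_diff v span_base span_zero)
      thus "w \<in> span B" by simp
    qed
    thus False using independent_span_bound[OF assms C(2)] C(1) by simp
  qed
  thus ?thesis by (auto simp: small_def)
qed

lemma not_small_if_infinite_independent:
  assumes "subspace V" "C \<subseteq> V" "independent C" "infinite C"
  shows "\<not> small V"
proof -
  have "contains_flat m V" for m
  proof -
    obtain B where B: "finite B" "card B = m" "B \<subseteq> C"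
      using infinite_arbitrarily_large[OF assms(4)] by blast
    have "(+) 0 ` span B \<subseteq> V" using span_minimal[OF _ assms(1), of B] B(3) assms(2) by auto
    thus ?thesis unfolding contains_flat_def using B independent_mono[OF assms(3) B(3)] by blast
  qed
  thus ?thesis by (simp add: small_def)
qed

section \<open>Greedy construction of an infinite-dimensional affine subspace\<close>

text \<open>The induction step of the greedy construction: the vectors \<open>x\<close> that are no use as a new
  direction form a small set, since \<open>span B\<close> is finite and small.\<close>

lemma extend_flat_avoiding_small:
  assumes "\<not> small V" "small R" "finite B" "(+) a ` span B \<inter> R = {}"
  obtains x where "x \<in> V" "x \<notin> span B" "(+) a ` span (insert x B) \<inter> R = {}"
proof -
  define bad where "bad = (\<Union>w\<in>span B. \<Union>c\<in>UNIV - {0}. {x. (a + w) + c *s x \<in> R})"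
  have "small bad"
    unfolding bad_def using finite_scalars assms(2,3)
    by (intro small_UN small_homothety_vimage finite_span) auto
  hence "small (bad \<union> span B)" by (intro small_Un small_span assms(3))
  hence "\<not> V \<subseteq> bad \<union> span B" using assms(1) small_subset by blast
  then obtain x where x: "x \<in> V" "x \<notin> bad" "x \<notin> span B" by blast
  have "a + y \<notin> R" if y: "y \<in> span (insert x B)" for y
  proof -
    obtain c where c: "y - c *s x \<in> span B" using y by (auto simp: span_insert)
    show ?thesis
    proof (cases "c = 0")
      case True
      thus ?thesis using c assms(4) by auto
    next
      case False
      hence "(a + (y - c *s x)) + c *s x \<notin> R" using x(2) c unfolding bad_def by blast
      thus ?thesis by (simp add: algebra_simps)
    qed
  qed
  with x that show thesis by blast
qed

text \<open>Iterating the extension step gives a chain of finite independent sets. Its union spans the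
  required direction, because a vector in the span of the union lies in the span of one of the
  sets.\<close>

theorem infinite_flat_avoiding_small:
  assumes V: "\<not> small V" and R: "small R"
  obtains a C where "a \<in> V" "C \<subseteq> V" "infinite C" "independent C" "(+) a ` span C \<inter> R = {}"
proof -
  obtain a where a: "a \<in> V" "a \<notin> R" using V R small_subset by blast
  define good where "good n B \<longleftrightarrow>
    finite B \<and> card B = n \<and> B \<subseteq> V \<and> independent B \<and> (+) a ` span B \<inter> R = {}" for n B
  have "\<exists>f. \<forall>n. good n (f n) \<and> f n \<subseteq> f (Suc n)"
  proof (rule dependent_nat_choice)
    show "\<exists>B. good 0 B" 
      using a independent_empty by (intro exI[of _ "{}"]) (simp add: good_def)
    fix B n assume B: "good n B"
    then obtain x where "x \<in> V" "x \<notin> span B" "(+) a ` span (insert x B) \<inter> R = {}"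
      using extend_flat_avoiding_small[OF V R] unfolding good_def by metis
    moreover from this have "x \<notin> B" using span_base by blast
    ultimately have "good (Suc n) (insert x B)"
      using B by (simp add: good_def independent_insert)
    thus "\<exists>B'. good (Suc n) B' \<and> B \<subseteq> B'" by blast
  qed
  then obtain f where f: "\<And>n. good n (f n)" "\<And>n. f n \<subseteq> f (Suc n)" by blast
  have mono: "f i \<subseteq> f j" if "i \<le> j" for i j using lift_Suc_mono_le[of f, OF f(2) that] .
  define C where "C = (\<Union>n. f n)"
  have "infinite C"
  proof
    assume "finite C"
    hence "card (f (Suc (card C))) \<le> card C" by (intro card_mono) (auto simp: C_def)
    thus False using f(1)[of "Suc (card C)"] by (simp add: good_def)
  qed
  moreover have "independent C"
    unfolding C_def using f(1) mono nat_le_linear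
    by (intro independent_Union_directed) (auto simp: good_def, metis subsetD)
  moreover have "(+) a ` span C \<inter> R = {}"
  proof -
    have "a + y \<notin> R" if y: "y \<in> span C" for y
    proof -
      obtain t r where t: "finite t" "t \<subseteq> C" "y = (\<Sum>b\<in>t. r b *s b)"
        using y unfolding span_explicit by blast
      have "subset.chain UNIV (range f)"
        unfolding subset_chain_def using mono nat_le_linear by blast
      with t obtain n where "t \<subseteq> f n"
        using finite_subset_Union_chain[of t "range f" UNIV] unfolding C_def by blast
      hence "y \<in> span (f n)" unfolding t(3) by (intro span_sum span_scale span_base) auto
      thus ?thesis using f(1)[of n] by (auto simp: good_def)
    qed
    thus ?thesis by blast
  qed
  moreover have "C \<subseteq> V" using f(1) by (auto simp: C_def good_def)
  ultimately show thesis using that a(1) by blast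
qed

end

section \<open>Affine subspaces in two-coloured spaces\<close>

theorem theorem13:
  fixes V :: "(nat \<Rightarrow>\<^sub>0 'a::{field, finite}) set"
    and k :: nat
    and \<Delta> :: "(nat \<Rightarrow>\<^sub>0 'a) \<Rightarrow> colour"
  assumes "fs.subspace V"
    and "countably_infinite_dim V"
    and "\<not> (\<exists>A. affine_subspace_of_dim V k A \<and> (\<forall>x\<in>A. \<Delta> x = Red))"
  shows "\<exists>A. affine_subspace_of_infinite_dim V A \<and> (\<forall>x\<in>A. \<Delta> x = Blue)"
proof -
  interpret ffs: finite_field_vector_space "fs_scale :: 'a \<Rightarrow> _"
    by unfold_locales simp
  define R where "R = {x \<in> V. \<Delta> x = Red}"
  have "\<not> ffs.contains_flat k R"
  proof
    assume "ffs.contains_flat k R"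
    then obtain v B where B: "finite B" "card B = k" "fs.independent B"
      and sub: "(+) v ` fs.span B \<subseteq> R"
      by (auto simp: ffs.contains_flat_def)
    have vw: "v + w \<in> R" if "w \<in> fs.span B" for w using sub that by blast
    have v: "v \<in> V" using vw[OF fs.span_zero] by (simp add: R_def)
    have "w \<in> V" if "w \<in> fs.span B" for w
    proof -
      have "(v + w) - v \<in> V" using vw[OF that] v by (intro fs.subspace_diff assms(1)) (auto simp: R_def)
      thus ?thesis by simp
    qed
    hence "affine_subspace_along V (fs.span B) {v + w | w. w \<in> fs.span B}"
      unfolding affine_subspace_along_def using v by auto
    moreover have "finite_dim (fs.span B)" using B by (auto simp: finite_dim_def)
    moreover have "fs.dim (fs.span B) = k" using B by (simp add: fs.dim_eq_card_independent)
    moreover have "\<forall>x\<in>{v + w | w. w \<in> fs.span B}. \<Delta> x = Red" using vw by (auto simp: R_def)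
    ultimately show False using assms(3) unfolding affine_subspace_of_dim_def by blast
  qed
  hence "ffs.small R" by (auto simp: ffs.small_def)
  moreover obtain D where "infinite D" "fs.independent D" "fs.span D = V"
    using assms(2) by (auto simp: countably_infinite_dim_def)
  hence "\<not> ffs.small V"
    using ffs.not_small_if_infinite_independent[OF assms(1)] fs.span_superset by metis
  \<comment> \<open>The set \<open>R\<close> lies within \<open>V\<close>, so avoiding it means being blue only for points of \<open>V\<close>;
    hence \<open>a \<in> V\<close> and \<open>C \<subseteq> V\<close> are needed.\<close>
  ultimately obtain a C where C: "a \<in> V" "C \<subseteq> V" "infinite C" "fs.independent C"
    and blue: "(+) a ` fs.span C \<inter> R = {}"
    using ffs.infinite_flat_avoiding_small by metis
  have sub: "fs.span C \<subseteq> V" using fs.span_minimal[OF C(2) assms(1)] .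
  have "\<not> finite_dim (fs.span C)"
  proof
    assume "finite_dim (fs.span C)"
    then obtain B where "finite B" "fs.span B = fs.span C" by (auto simp: finite_dim_def)
    hence "finite C" using fs.independent_span_bound[of B C] C(4) fs.span_superset by metis
    with C(3) show False ..
  qed
  moreover have "affine_subspace_along V (fs.span C) {a + w | w. w \<in> fs.span C}"
    unfolding affine_subspace_along_def using sub C(1) by auto
  moreover have "\<Delta> (a + w) = Blue" if "w \<in> fs.span C" for w
  proof -
    have "a + w \<in> V" using that sub C(1) by (intro fs.subspace_add assms(1)) auto
    thus ?thesis using blue that by (cases "\<Delta> (a + w)") (auto simp: R_def)
  qed
  ultimately show ?thesis unfolding affine_subspace_of_infinite_dim_def by blast
qed

end
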